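(* Let $\mu$ be the mean value of workers' accuracy ($\mu\neq\frac12$) and let $C\in[0,1)$ be a required accuracy. If the number $n$ of workers (an odd positive integer) satisfies $$n \ge \frac{-\ln(1-C)}{2\left(\mu-\frac12\right)^2},$$ then the expected accuracy of the crowdsourcing result is no less than $C$, i.e. $E[P_{\frac n2}]\ge C$.
   Context: A task is answered by $n$ workers $\mathcal U=\{u_1,\dots,u_n\}$, where $n$ is an odd positive integer. The accuracy $a_i\in[0,1]$ of worker $u_i$ is the probability that $u_i$ provides a correct answer. Workers are randomly drawn and answer independently, so $a_1,\dots,a_n$ are independent random variables, each with mean $E[a_i]=\mu$. For given accuracies, $P_{\frac n2}$ denotes the probability that at least $\lceil \frac n2\rceil$ workers provide the correct answer, i.e. $$P_{\frac n2}=\sum_{\mathbb U\subseteq\mathcal U,\ |\mathbb U|\ge\lceil n/2\rceil}\ \Big(\prod_{u_i\in\mathbb U}a_i\prod_{u_j\notin\mathbb U}(1-a_j)\Big),$$ and $E[P_{\frac n2}]$ is its expectation over the random accuracies. The expected accuracy of the crowdsourcing result (under voting) means $E[P_{\frac n2}]$.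
   Formalization: The condition μ ≠ 1/2 is replaced by μ > 1/2, since the claim fails for μ < 1/2: with n = 1, accuracy identically 0 and C = 1/4, the bound on n holds (about 0.575 ≤ 1) but the expected accuracy is 0. *)

theory Defs
  imports "HOL-Probability.Probability"
begin

text \<open>
  The accuracies \<open>a\<close> are fixed numbers here. The summand for \<open>S\<close> is the probability that exactly the
  workers in \<open>S\<close> answer correctly, the workers answering independently of each other.
\<close>

definition majority_prob :: "'u set \<Rightarrow> ('u \<Rightarrow> real) \<Rightarrow> real" where
  "majority_prob U a =
     (\<Sum>S | S \<subseteq> U \<and> int (card S) \<ge> \<lceil>real (card U) / 2\<rceil>. (\<Prod>u\<in>S. a u) * (\<Prod>u\<in>U - S. 1 - a u))"

text \<open>\<open>a u \<omega>\<close> is the accuracy of worker \<open>u\<close> in the outcome \<open>\<omega>\<close> of the random draw of the workers.\<close>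

definition expected_majority_prob :: "'w measure \<Rightarrow> 'u set \<Rightarrow> ('u \<Rightarrow> 'w \<Rightarrow> real) \<Rightarrow> real" where
  "expected_majority_prob M U a = (\<integral>\<omega>. majority_prob U (\<lambda>u. a u \<omega>) \<partial>M)"

end

theory Submission
  imports Defs
begin

text \<open>
  Each summand of the majority probability is multilinear in the accuracies, so by independence the
  expectation replaces every accuracy by \<open>\<mu>\<close>. In the complementary event fewer than half of the
  workers are right, so each of its at most \<open>2 ^ n\<close> configurations has probability at most
  \<open>sqrt (\<mu> * (1 - \<mu>)) ^ n\<close>. Finally \<open>4 * \<mu> * (1 - \<mu>) = 1 - 4 * (\<mu> - 1 / 2)\<^sup>2 \<le> exp (- 4 * (\<mu> - 1 / 2)\<^sup>2)\<close>.
\<close>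

text \<open>Integrability is recorded as well because exchanging the integral with the sum over
  \<open>S\<close> requires it.\<close>

lemma (in prob_space) expectation_prod_split:
  fixes a :: "'u \<Rightarrow> 'a \<Rightarrow> real"
  assumes fin: "finite U" and S: "S \<subseteq> U"
    and indep: "indep_vars (\<lambda>_. borel) a U"
    and int: "\<And>u. u \<in> U \<Longrightarrow> integrable M (a u)"
  shows "integrable M (\<lambda>\<omega>. (\<Prod>u\<in>S. a u \<omega>) * (\<Prod>u\<in>U - S. 1 - a u \<omega>))"
    and "(\<integral>\<omega>. (\<Prod>u\<in>S. a u \<omega>) * (\<Prod>u\<in>U - S. 1 - a u \<omega>) \<partial>M) =
      (\<Prod>u\<in>S. expectation (a u)) * (\<Prod>u\<in>U - S. 1 - expectation (a u))"
proof -
  \<comment> \<open>Both products merge into one over \<open>U\<close>. Each \<open>b u\<close> is a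
    function of \<open>a u\<close> alone, so the family \<open>b\<close> inherits
    independence.\<close>
  define b where "b u \<omega> = (if u \<in> S then a u \<omega> else 1 - a u \<omega>)" for u \<omega>
  have indep_b: "indep_vars (\<lambda>_. borel) b U"
    using indep_vars_compose2[OF indep, where Y = "\<lambda>u x. if u \<in> S then x else 1 - x" and N = "\<lambda>_. borel"]
    unfolding b_def by simp
  have int_b: "integrable M (b u)" if "u \<in> U" for u
    using int[OF that] unfolding b_def by (cases "u \<in> S") auto
  have split: "(\<Prod>u\<in>U. if u \<in> S then f u else g u) = (\<Prod>u\<in>S. f u) * (\<Prod>u\<in>U - S. g u)"
    for f g :: "'u \<Rightarrow> real"
    using fin S by (simp add: prod.If_cases Diff_eq Int_absorb1)
  have b: "(\<lambda>\<omega>. \<Prod>u\<in>U. b u \<omega>) = (\<lambda>\<omega>. (\<Prod>u\<in>S. a u \<omega>) * (\<Prod>u\<in>U - S. 1 - a u \<omega>))"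
    unfolding b_def split ..
  show "integrable M (\<lambda>\<omega>. (\<Prod>u\<in>S. a u \<omega>) * (\<Prod>u\<in>U - S. 1 - a u \<omega>))"
    using indep_vars_integrable[OF fin indep_b int_b] unfolding b .
  have "(\<integral>\<omega>. (\<Prod>u\<in>U. b u \<omega>) \<partial>M) = (\<Prod>u\<in>U. expectation (b u))"
    by (rule indep_vars_lebesgue_integral[OF fin indep_b int_b])
  also have "\<dots> = (\<Prod>u\<in>U. if u \<in> S then expectation (a u) else 1 - expectation (a u))"
    using int by (intro prod.cong) (auto simp: b_def[abs_def] prob_space)
  finally show "(\<integral>\<omega>. (\<Prod>u\<in>S. a u \<omega>) * (\<Prod>u\<in>U - S. 1 - a u \<omega>) \<partial>M) =
      (\<Prod>u\<in>S. expectation (a u)) * (\<Prod>u\<in>U - S. 1 - expectation (a u))"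
    unfolding b split .
qed

lemma (in prob_space) expected_majority_prob_indep:
  fixes a :: "'u \<Rightarrow> 'a \<Rightarrow> real"
  assumes "finite U" and "indep_vars (\<lambda>_. borel) a U"
    and "\<And>u. u \<in> U \<Longrightarrow> integrable M (a u)"
  shows "expected_majority_prob M U a = majority_prob U (\<lambda>u. expectation (a u))"
  unfolding expected_majority_prob_def majority_prob_def
  using expectation_prod_split[OF assms(1) _ assms(2,3)]
  by (subst Bochner_Integration.integral_sum) (auto intro!: sum.cong)

text \<open>Pair each of the \<open>k\<close> factors \<open>p\<close> with a factor
  \<open>q\<close>; each of the \<open>m - k\<close> surplus factors \<open>q\<close> is at most
  \<open>sqrt (p * q)\<close>.\<close>

lemma power_mult_power_le_sqrt_power:
  fixes p q :: real
  assumes "0 \<le> q" and "q \<le> p" and "k \<le> m"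
  shows "p ^ k * q ^ m \<le> sqrt (p * q) ^ (k + m)"
proof -
  have "p ^ k * q ^ m = (p * q) ^ k * sqrt (q * q) ^ (m - k)"
    using assms by (simp add: power_mult_distrib flip: power_add)
  also have "\<dots> \<le> (p * q) ^ k * sqrt (p * q) ^ (m - k)"
    using assms by (intro mult_left_mono power_mono real_sqrt_le_mono mult_right_mono) auto
  also have "(p * q) ^ k = sqrt (p * q) ^ (2 * k)"
    using assms by (simp add: power_mult)
  finally show ?thesis
    using assms by (simp flip: power_add)
qed

text \<open>This is Hoeffding's bound for the lower tail at one half. Since
  \<open>1 / 2 \<le> p\<close>, the smaller factor \<open>1 - p\<close> carries the larger exponent
  in every minority term.\<close>

lemma majority_prob_const_ge:
  fixes p :: real
  assumes fin: "finite U" and p: "1 / 2 \<le> p" "p \<le> 1"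
  shows "1 - majority_prob U (\<lambda>_. p) \<le> exp (- 2 * real (card U) * (p - 1 / 2)\<^sup>2)"
proof -
  let ?maj = "\<lambda>S. int (card S) \<ge> \<lceil>real (card U) / 2\<rceil>"
  let ?t = "\<lambda>S. (\<Prod>u\<in>S. p) * (\<Prod>u\<in>U - S. 1 - p)"
  let ?r = "sqrt (p * (1 - p))"
  \<comment> \<open>Expanding the product over \<open>U\<close> shows that the total mass is
    1.\<close>
  have "(\<Sum>S\<in>Pow U. ?t S) = (\<Prod>u\<in>U. p + (1 - p))"
    using prod_add[OF fin, of "\<lambda>_. p" "\<lambda>_. 1 - p"] by simp
  moreover have "(\<Sum>S\<in>Pow U. ?t S) = (\<Sum>S | S \<subseteq> U \<and> ?maj S. ?t S) + (\<Sum>S | S \<subseteq> U \<and> \<not> ?maj S. ?t S)"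
    using fin by (subst sum.union_disjoint[symmetric]) (auto intro!: sum.cong)
  ultimately have "1 - majority_prob U (\<lambda>_. p) = (\<Sum>S | S \<subseteq> U \<and> \<not> ?maj S. ?t S)"
    by (simp add: majority_prob_def)
  also have "\<dots> \<le> (\<Sum>S | S \<subseteq> U \<and> \<not> ?maj S. ?r ^ card U)"
  proof (intro sum_mono)
    fix S assume "S \<in> {S. S \<subseteq> U \<and> \<not> ?maj S}"
    then have S: "S \<subseteq> U" "real (card S) < real (card U) / 2"
      by (auto simp: not_le less_ceiling_iff)
    then have "card S + card (U - S) = card U"
      using fin by (simp add: card_Diff_subset finite_subset card_mono)
    moreover from this have "card S \<le> card (U - S)"
      using S by linarith
    ultimately show "?t S \<le> ?r ^ card U"
      using p power_mult_power_le_sqrt_power[of "1 - p" p "card S" "card (U - S)"] by simp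
  qed
  also have "\<dots> \<le> 2 ^ card U * ?r ^ card U"
  proof -
    have "card {S. S \<subseteq> U \<and> \<not> ?maj S} \<le> card (Pow U)"
      using fin by (intro card_mono) auto
    also have "\<dots> = 2 ^ card U"
      using fin by (rule card_Pow)
    finally have "real (card {S. S \<subseteq> U \<and> \<not> ?maj S}) \<le> 2 ^ card U"
      by (metis of_nat_le_iff of_nat_numeral of_nat_power)
    then show ?thesis
      using p by (simp add: mult_right_mono)
  qed
  also have "\<dots> = (2 * ?r) ^ card U"
    by (simp add: power_mult_distrib)
  also have "\<dots> \<le> exp (- 2 * (p - 1 / 2)\<^sup>2) ^ card U"
  proof (intro power_mono)
    \<comment> \<open>The bound is established under the square root: the root turns 4 into the
      factor 2 of \<open>2 * ?r\<close> and halves the exponent.\<close>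
    have "4 * (p * (1 - p)) = 1 + - 4 * (p - 1 / 2)\<^sup>2"
      by (simp add: power2_eq_square algebra_simps)
    also have "\<dots> \<le> exp (- 4 * (p - 1 / 2)\<^sup>2)"
      by (rule exp_ge_add_one_self)
    also have "\<dots> = (exp (- 2 * (p - 1 / 2)\<^sup>2))\<^sup>2"
      by (simp flip: exp_double)
    finally have "sqrt (4 * (p * (1 - p))) \<le> exp (- 2 * (p - 1 / 2)\<^sup>2)"
      by (intro real_le_lsqrt) auto
    then show "2 * ?r \<le> exp (- 2 * (p - 1 / 2)\<^sup>2)"
      by (simp add: real_sqrt_mult)
  qed (use p in simp)
  also have "\<dots> = exp (- 2 * real (card U) * (p - 1 / 2)\<^sup>2)"
    by (simp add: mult_ac flip: exp_of_nat_mult)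
  finally show ?thesis .
qed

text \<open>The mean must lie above one half, not merely differ from it: for
  \<open>\<mu> = 0\<close>, \<open>n = 3\<close> and \<open>C = 1 / 2\<close> the bound on
  \<open>n\<close> holds, but the expected accuracy is 0.\<close>

theorem theorem3:
  fixes M :: "'w measure" and U :: "'u set" and a :: "'u \<Rightarrow> 'w \<Rightarrow> real"
    and n :: nat and \<mu> C :: real
  assumes "prob_space M"
    and "finite U" and "card U = n" and "odd n"
    and "prob_space.indep_vars M (\<lambda>_. borel) a U"
    and "\<And>u \<omega>. u \<in> U \<Longrightarrow> \<omega> \<in> space M \<Longrightarrow> a u \<omega> \<in> {0..1}"
    and "\<And>u. u \<in> U \<Longrightarrow> (\<integral>\<omega>. a u \<omega> \<partial>M) = \<mu>"
    and "\<mu> > 1 / 2"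
    and "C \<in> {0..<1}"
    and "real n \<ge> - ln (1 - C) / (2 * (\<mu> - 1 / 2)\<^sup>2)"
  shows "expected_majority_prob M U a \<ge> C"
proof -
  interpret prob_space M by fact
  have int: "integrable M (a u)" if "u \<in> U" for u
    using assms(5,6) that
    by (intro integrable_const_bound[of _ 1]) (auto simp: indep_vars_def)
  \<comment> \<open>An odd \<open>n\<close> is nonzero, so some worker exists, and the mean of that
    worker's accuracy forces \<open>\<mu> \<le> 1\<close>.\<close>
  obtain u where u: "u \<in> U"
    using assms(3,4) by fastforce
  have "expectation (a u) \<le> 1"
    using assms(6) u by (intro integral_le_const int) auto
  then have "\<mu> \<le> 1"
    using assms(7) u by simp
  have "expected_majority_prob M U a = majority_prob U (\<lambda>u. expectation (a u))"
    using assms(2,5) int by (rule expected_majority_prob_indep)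
  \<comment> \<open>The means are known only on \<open>U\<close>, hence the congruence inside the
    products.\<close>
  also have "\<dots> = majority_prob U (\<lambda>_. \<mu>)"
    unfolding majority_prob_def using assms(7)
    by (intro sum.cong refl arg_cong2[where f = "(*)"] prod.cong) auto
  finally have "1 - expected_majority_prob M U a \<le> exp (- 2 * real n * (\<mu> - 1 / 2)\<^sup>2)"
    using majority_prob_const_ge[of U \<mu>] assms(2,3,8) \<open>\<mu> \<le> 1\<close> by simp
  \<comment> \<open>This is the assumed bound on \<open>n\<close>, multiplied by its positive
    denominator.\<close>
  also have "\<dots> \<le> exp (ln (1 - C))"
    using assms(8,10) by (simp add: divide_simps mult_ac)
  also have "\<dots> = 1 - C"
    using assms(9) by simp
  finally show ?thesis by simp
qed

end
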